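(* Let $G=(V,E)$ be a directed graph on $n$ vertices with unit edge capacities (parallel edges allowed), a designated source vertex $s$ and a designated sink vertex $t$. Any data structure that, given any pair of edges $e_1,e_2\in E$ and values $\Delta_1,\Delta_2\in\{-1\}$, reports the capacity of the $(s,t)$-mincut after changing the capacities of $e_1,e_2$ from $w(e_1),w(e_2)$ to $w(e_1)+\Delta_1,w(e_2)+\Delta_2$, must occupy $\Omega(n^2)$ bits of space in the worst case, irrespective of its query time.
   Context: An $(s,t)$-cut is a set $C\subset V$ with $s\in C$, $t\notin C$; its capacity is the total capacity of edges from $C$ to $V\setminus C$; the $(s,t)$-mincut capacity is the minimum capacity of an $(s,t)$-cut. *)

theory Defs
  imports Complex_Main "HOL-Library.Extended_Nat" "Graph_Theory.Digraph"
begin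

definition st_cuts :: "('a, 'b) pre_digraph \<Rightarrow> 'a \<Rightarrow> 'a \<Rightarrow> 'a set set" where
  "st_cuts G s t = {C. C \<subset> verts G \<and> s \<in> C \<and> t \<notin> C}"

definition cut_capacity :: "('a, 'b) pre_digraph \<Rightarrow> ('b \<Rightarrow> int) \<Rightarrow> 'a set \<Rightarrow> int" where
  "cut_capacity G w C = (\<Sum>e \<in> {e \<in> arcs G. tail G e \<in> C \<and> head G e \<in> verts G - C}. w e)"

definition mincut_capacity :: "('a, 'b) pre_digraph \<Rightarrow> ('b \<Rightarrow> int) \<Rightarrow> 'a \<Rightarrow> 'a \<Rightarrow> int" where
  "mincut_capacity G w s t = Min (cut_capacity G w ` st_cuts G s t)"

text \<open>
  Parallel arcs are distinguished by a copy index: the arcs from \<open>u\<close> to \<open>v\<close> are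
  \<open>(u, v, 0), \<dots>, (u, v, m u v - 1)\<close>. Every finite directed multigraph on \<open>n\<close> vertices is of
  this form up to renaming. Arc names are canonical on purpose: a query mentions arcs by
  name, and arbitrary names could themselves carry an unbounded amount of information.
\<close>

type_synonym multi_arc = "nat \<times> nat \<times> nat"
type_synonym multigraph = "(nat, multi_arc) pre_digraph"

definition multigraph_of :: "nat \<Rightarrow> (nat \<Rightarrow> nat \<Rightarrow> nat) \<Rightarrow> multigraph" where
  "multigraph_of n m =
    \<lparr>verts = {..<n}, arcs = {(u, v, k). u < n \<and> v < n \<and> k < m u v},
     tail = (\<lambda>(u, v, k). u), head = (\<lambda>(u, v, k). v)\<rparr>"

lemma fin_digraph_multigraph_of: "fin_digraph (multigraph_of n m)"
proof -
  have "{(u, v, k). u < n \<and> v < n \<and> k < m u v} =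
      (SIGMA u:{..<n}. SIGMA v:{..<n}. {..<m u v})"
    by auto
  then have "finite {(u, v, k). u < n \<and> v < n \<and> k < m u v}"
    by simp
  then show ?thesis
    by unfold_locales (auto simp: multigraph_of_def)
qed

text \<open>
  The parameter \<open>\<mu>\<close> limits how many parallel copies an arc may have; \<open>\<mu> = \<infinity>\<close> gives all
  directed multigraphs and \<open>\<mu> = 1\<close> the simple ones. With unlimited multiplicity the
  capacity to be reported is unbounded for fixed \<open>n\<close>, so that no finite worst-case space
  bound can exist; a lower bound in terms of \<open>n\<close> has content for finite \<open>\<mu>\<close>.
\<close>

definition multigraphs :: "nat \<Rightarrow> enat \<Rightarrow> multigraph set" where
  "multigraphs n \<mu> = {multigraph_of n m | m. \<forall>u v. enat (m u v) \<le> \<mu>}"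

definition unit_capacity :: "'b \<Rightarrow> int" where
  "unit_capacity = (\<lambda>_. 1)"

text \<open>
  A data structure is a pair of functions: \<open>enc\<close> is the bit string stored for a graph and
  \<open>query\<close> answers from that string and the query alone. Both are arbitrary functions, so no
  restriction is placed on preprocessing or query time.
\<close>

definition dual_decrement_oracle ::
  "multigraph set \<Rightarrow> nat \<Rightarrow> nat \<Rightarrow> (multigraph \<Rightarrow> bool list) \<Rightarrow>
    (bool list \<Rightarrow> multi_arc \<times> int \<Rightarrow> multi_arc \<times> int \<Rightarrow> int) \<Rightarrow> bool" where
  "dual_decrement_oracle \<G> s t enc query \<longleftrightarrow>
    (\<forall>G\<in>\<G>. \<forall>e\<^sub>1\<in>arcs G. \<forall>e\<^sub>2\<in>arcs G. \<forall>\<Delta>\<^sub>1\<in>{-1}. \<forall>\<Delta>\<^sub>2\<in>{-1}. e\<^sub>1 \<noteq> e\<^sub>2 \<longrightarrow>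
      query (enc G) (e\<^sub>1, \<Delta>\<^sub>1) (e\<^sub>2, \<Delta>\<^sub>2) =
        mincut_capacity G
          (unit_capacity(e\<^sub>1 := unit_capacity e\<^sub>1 + \<Delta>\<^sub>1, e\<^sub>2 := unit_capacity e\<^sub>2 + \<Delta>\<^sub>2)) s t)"

end

(* Join the source s to each of N inner vertices and each of these to the sink t, split the inner
   vertices into two halves L and R, and add an arbitrary set E of arcs from L to R. For i in L and
   j in R delete the arcs (i, t) and (s, j). The two-arc paths through the N - 2 other inner vertices
   are intact, and what remains of the paths through i and j is joined into one more path exactly if
   (i, j) is in E. So the mincut has capacity N - 1 if (i, j) is in E and N - 2 otherwise, and the
   answers of the data structure determine E, that is, |L| |R| bits. *)

theory Submission
  imports Defs
begin

section \<open>Counting bit strings by length\<close>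

lemma card_bool_lists_length_less:
  "finite {xs :: bool list. length xs < m}" "card {xs :: bool list. length xs < m} < 2 ^ m"
proof -
  have eq: "{xs :: bool list. length xs < m} = (\<Union>k<m. {xs. set xs \<subseteq> UNIV \<and> length xs = k})"
    by auto
  show "finite {xs :: bool list. length xs < m}"
    unfolding eq by (intro finite_UN_I finite_lists_length_eq) auto
  have "card {xs :: bool list. length xs < m}
      \<le> (\<Sum>k<m. card {xs :: bool list. set xs \<subseteq> UNIV \<and> length xs = k})"
    unfolding eq by (rule card_UN_le) simp
  also have "\<dots> = (\<Sum>k<m. 2 ^ k)"
    by (intro sum.cong refl, subst card_lists_length_eq) auto
  also have "\<dots> < (2::nat) ^ m"
    by (induction m) auto
  finally show "card {xs :: bool list. length xs < m} < 2 ^ m" .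
qed

text \<open>Pigeonhole: there are too few strings shorter than \<open>m\<close> to give
  \<open>2 ^ m\<close> objects distinct codes.\<close>

lemma inj_on_bool_lists_long:
  fixes f :: "'a \<Rightarrow> bool list"
  assumes "inj_on f A" "2 ^ m \<le> card A"
  shows "\<exists>a\<in>A. m \<le> length (f a)"
proof (rule ccontr)
  assume "\<not> ?thesis"
  then have "f ` A \<subseteq> {xs. length xs < m}"
    by auto
  then have "card A \<le> card {xs :: bool list. length xs < m}"
    using assms(1) card_bool_lists_length_less(1) by (metis card_image card_mono)
  then show False
    using assms(2) card_bool_lists_length_less(2)[of m] by linarith
qed

section \<open>Mincuts after the deletion of two arcs\<close>

definition decrement_two :: "'b \<Rightarrow> 'b \<Rightarrow> 'b \<Rightarrow> int" where
  "decrement_two e1 e2 =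
    unit_capacity(e1 := unit_capacity e1 + -1, e2 := unit_capacity e2 + -1)"

text \<open>A decremented unit arc has weight 0, so decrementing acts as deletion and a capacity
  becomes a cardinality.\<close>

lemma cut_capacity_decrement_two:
  assumes "finite (arcs G)" "e1 \<noteq> e2"
  shows "cut_capacity G (decrement_two e1 e2) C
    = int (card ({e \<in> arcs G. tail G e \<in> C \<and> head G e \<in> verts G - C} - {e1, e2}))"
proof -
  let ?D = "{e \<in> arcs G. tail G e \<in> C \<and> head G e \<in> verts G - C}"
  let ?w = "decrement_two e1 e2"
  have fin: "finite ?D"
    using assms(1) by simp
  have "sum ?w ?D = sum ?w (?D - {e1, e2})"
    using fin assms(2)
    by (intro sum.mono_neutral_right) (auto simp: decrement_two_def unit_capacity_def)
  also have "\<dots> = (\<Sum>e\<in>?D - {e1, e2}. 1)"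
    by (intro sum.cong) (auto simp: decrement_two_def unit_capacity_def)
  finally show ?thesis
    by (simp add: cut_capacity_def)
qed

lemma finite_st_cuts: "finite (verts G) \<Longrightarrow> finite (st_cuts G s t)"
  by (rule finite_subset[of _ "Pow (verts G)"]) (auto simp: st_cuts_def)

lemma mincut_capacity_le:
  "finite (verts G) \<Longrightarrow> C \<in> st_cuts G s t \<Longrightarrow> mincut_capacity G w s t \<le> cut_capacity G w C"
  by (simp add: mincut_capacity_def finite_st_cuts)

lemma mincut_capacity_ge:
  assumes "finite (verts G)" "s \<in> verts G" "t \<in> verts G" "s \<noteq> t"
    and "\<And>C. C \<in> st_cuts G s t \<Longrightarrow> b \<le> cut_capacity G w C"
  shows "b \<le> mincut_capacity G w s t"
proof -
  \<comment> \<open>\<open>Min\<close> says nothing about an empty set, so some cut must be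
    exhibited; \<open>t\<close> makes the inclusion proper.\<close>
  have "{s} \<subset> verts G"
    using assms(2-4) by (intro psubsetI) (simp, metis singletonD)
  then have "{s} \<in> st_cuts G s t"
    using assms(4) by (simp add: st_cuts_def)
  then show ?thesis
    unfolding mincut_capacity_def using assms by (subst Min_ge_iff) (auto simp: finite_st_cuts)
qed

section \<open>The graphs that encode an arbitrary bipartite relation\<close>

locale bipartite_gadget =
  fixes n s t :: nat and L R :: "nat set"
  assumes inner: "L \<union> R = {..<n} - {s, t}" and disj: "L \<inter> R = {}"
    and st: "s < n" "t < n" "s \<noteq> t"
begin

text \<open>With \<open>of_bool\<close> no arc has a parallel copy, so the graph is available for
  every \<mu> from 1 on.\<close>

definition graph :: "(nat \<times> nat) set \<Rightarrow> multigraph" where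
  "graph E = multigraph_of n (\<lambda>u v. of_bool
    (u = s \<and> v \<in> L \<union> R \<or> u \<in> L \<union> R \<and> v = t \<or> (u, v) \<in> E \<inter> L \<times> R))"

lemma in_L: "v \<in> L \<Longrightarrow> v < n \<and> v \<noteq> s \<and> v \<noteq> t \<and> v \<notin> R"
  and in_R: "v \<in> R \<Longrightarrow> v < n \<and> v \<noteq> s \<and> v \<noteq> t \<and> v \<notin> L"
  using inner disj by blast+

lemma finite_inner: "finite (L \<union> R)"
  unfolding inner by simp

lemma verts_graph: "verts (graph E) = {..<n}"
  by (simp add: graph_def multigraph_of_def)

lemma finite_arcs_graph: "finite (arcs (graph E))"
  unfolding graph_def
  using fin_digraph_multigraph_of fin_digraph.finite_arcs by blast

lemma arcs_graph:
  "(u, v, k) \<in> arcs (graph E) \<longleftrightarrow>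
    k = 0 \<and> (u = s \<and> v \<in> L \<union> R \<or> u \<in> L \<union> R \<and> v = t \<or> (u, v) \<in> E \<inter> L \<times> R)"
  using st by (auto simp: graph_def multigraph_of_def dest: in_L in_R)

lemma ends_graph [simp]:
  "tail (graph E) (u, v, k) = u" "head (graph E) (u, v, k) = v"
  by (auto simp: graph_def multigraph_of_def)

lemma graph_in_multigraphs:
  assumes "1 \<le> \<mu>"
  shows "graph E \<in> multigraphs n \<mu>"
proof -
  have "enat (of_bool b) \<le> \<mu>" for b
    using assms by (cases b) (auto simp: one_enat_def zero_enat_def[symmetric])
  then show ?thesis
    unfolding graph_def multigraphs_def by blast
qed

abbreviation cut_arcs :: "(nat \<times> nat) set \<Rightarrow> nat set \<Rightarrow> multi_arc set" where
  "cut_arcs E C \<equiv>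
    {e \<in> arcs (graph E). tail (graph E) e \<in> C \<and> head (graph E) e \<in> verts (graph E) - C}"

definition mincut_without :: "(nat \<times> nat) set \<Rightarrow> nat \<Rightarrow> nat \<Rightarrow> int" where
  "mincut_without E i j =
    mincut_capacity (graph E) (decrement_two (i, t, 0) (s, j, 0)) s t"

lemma mincut_without_arc:
  assumes ij: "i \<in> L" "j \<in> R" and "(i, j) \<notin> E"
  shows "mincut_without E i j \<le> int (card (L \<union> R)) - 2"
proof -
  \<comment> \<open>Deletion makes it free to keep \<open>i\<close> with \<open>s\<close> and
    \<open>j\<close> with \<open>t\<close>. With the rest of \<open>L\<close> on the sink side and
    the rest of \<open>R\<close> on the source side, the only arc from \<open>L\<close> to
    \<open>R\<close> that could be cut is \<open>(i, j)\<close>.\<close>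
  let ?C = "insert s (insert i (R - {j}))"
  let ?D = "cut_arcs E ?C - {(i, t, 0), (s, j, 0)}"
  have "?C \<in> st_cuts (graph E) s t"
    using st ij by (auto simp: st_cuts_def verts_graph dest: in_L in_R)
  then have "mincut_without E i j \<le> cut_capacity (graph E) (decrement_two (i, t, 0) (s, j, 0)) ?C"
    unfolding mincut_without_def by (intro mincut_capacity_le) (simp add: verts_graph)
  also have "(i, t, 0::nat) \<noteq> (s, j, 0)"
    using ij in_R by blast
  then have "cut_capacity (graph E) (decrement_two (i, t, 0) (s, j, 0)) ?C = int (card ?D)"
    by (rule cut_capacity_decrement_two[OF finite_arcs_graph])
  finally have "mincut_without E i j \<le> int (card ?D)" .
  \<comment> \<open>Each inner vertex other than \<open>i\<close> and \<open>j\<close> pays for the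
    one cut arc on its two-arc path.\<close>
  moreover have "?D \<subseteq> (\<lambda>v. if v \<in> ?C then (v, t, 0) else (s, v, 0)) ` (L \<union> R - {i, j})"
    (is "_ \<subseteq> ?g ` _")
  proof
    fix e assume e: "e \<in> ?D"
    obtain u v k where uvk: "e = (u, v, k)"
      by (cases e)
    have arc: "u = s \<and> v \<in> L \<union> R \<or> u \<in> L \<union> R \<and> v = t \<or> (u, v) \<in> E \<inter> L \<times> R" and "k = 0"
      and uv: "u \<in> ?C" "v \<notin> ?C" "(u, v) \<noteq> (i, t)" "(u, v) \<noteq> (s, j)"
      using e unfolding uvk by (auto simp: arcs_graph)
    from arc consider "u = s" "v \<in> L \<union> R" | "u \<in> L \<union> R" "v = t" | "(u, v) \<in> E \<inter> L \<times> R"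
      by blast
    then show "e \<in> ?g ` (L \<union> R - {i, j})"
    proof cases
      case 1
      with uv have "v \<in> L \<union> R - {i, j}" "e = ?g v"
        using uvk \<open>k = 0\<close> by simp_all
      then show ?thesis
        by (rule rev_image_eqI)
    next
      case 2
      with uv have "u \<in> L \<union> R - {i, j}" "e = ?g u"
        using uvk \<open>k = 0\<close> ij in_L in_R by auto
      then show ?thesis
        by (rule rev_image_eqI)
    next
      case 3
      with uv have "u = i" "v = j"
        using in_L by blast+
      with 3 \<open>(i, j) \<notin> E\<close> show ?thesis
        by blast
    qed
  qed
  then have "card ?D \<le> card (L \<union> R - {i, j})"
    by (rule surj_card_le[rotated]) (use finite_inner in simp)
  \<comment> \<open>Guards against truncation of the natural subtraction below.\<close>
  moreover have "card {i, j} \<le> card (L \<union> R)"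
    using finite_inner ij by (intro card_mono) auto
  moreover have "card (L \<union> R - {i, j}) = card (L \<union> R) - card {i, j}"
    using ij by (intro card_Diff_subset) auto
  moreover have "i \<noteq> j"
    using ij in_L by blast
  then have "card {i, j} = 2"
    by simp
  ultimately show ?thesis
    by linarith
qed

text \<open>Only the easy half of max-flow min-cut is needed: the surviving paths are arc-disjoint,
  and a cut contains an arc of each. Disjointness appears as injectivity of
  \<open>f\<close>.\<close>

lemma mincut_with_arc:
  assumes ij: "i \<in> L" "j \<in> R" and arc: "(i, j) \<in> E"
  shows "int (card (L \<union> R)) - 1 \<le> mincut_without E i j"
  unfolding mincut_without_def
proof (rule mincut_capacity_ge)
  fix C assume C: "C \<in> st_cuts (graph E) s t"
  let ?D = "cut_arcs E C - {(i, t, 0), (s, j, 0)}"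
  \<comment> \<open>the arc of the surviving path through \<open>v\<close> that is cut; \<open>i\<close> stands for the path \<open>s, i, j, t\<close>\<close>
  define f where "f v = (if v = i \<and> i \<in> C then (if j \<in> C then (j, t, 0) else (i, j, 0))
    else if v \<in> C then (v, t, 0) else (s, v, 0::nat))" for v
  have "s \<in> C" "t \<notin> C"
    using C by (auto simp: st_cuts_def)
  have "f ` (L \<union> R - {j}) \<subseteq> ?D"
    using ij arc st \<open>s \<in> C\<close> \<open>t \<notin> C\<close>
    by (auto simp: f_def arcs_graph verts_graph dest: in_L in_R)
  moreover have "inj_on f (L \<union> R - {j})"
    using ij st by (auto simp: inj_on_def f_def split: if_splits dest: in_L in_R)
  ultimately have "card (L \<union> R - {j}) \<le> card ?D"
    using finite_arcs_graph by (intro card_inj_on_le) auto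
  moreover have "card (L \<union> R - {j}) + 1 = card (L \<union> R)"
    using finite_inner ij card_Suc_Diff1[of "L \<union> R" j] by simp
  moreover have "(i, t, 0::nat) \<noteq> (s, j, 0)"
    using ij in_R by blast
  ultimately show "int (card (L \<union> R)) - 1 \<le>
      cut_capacity (graph E) (decrement_two (i, t, 0) (s, j, 0)) C"
    using cut_capacity_decrement_two[OF finite_arcs_graph] by simp
qed (use st in \<open>auto simp: verts_graph\<close>)

text \<open>The queried arcs \<open>(i, t, 0)\<close> and \<open>(s, j, 0)\<close> lie in every
  \<open>graph E\<close>, so the queries themselves reveal nothing about \<open>E\<close>: the
  answers depend on it only through the code.\<close>

lemma oracle_inj_on:
  assumes query: "dual_decrement_oracle (multigraphs n \<mu>) s t enc query" and "1 \<le> \<mu>"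
  shows "inj_on (\<lambda>E. enc (graph E)) (Pow (L \<times> R))"
proof -
  have answer: "query (enc (graph E)) ((i, t, 0), -1) ((s, j, 0), -1) = mincut_without E i j"
    if "i \<in> L" "j \<in> R" for E i j
  proof -
    have "(i, t, 0) \<in> arcs (graph E)" "(s, j, 0) \<in> arcs (graph E)" "(i, t, 0::nat) \<noteq> (s, j, 0)"
      using that in_R by (auto simp: arcs_graph)
    then show ?thesis
      using query graph_in_multigraphs[OF \<open>1 \<le> \<mu>\<close>]
      unfolding dual_decrement_oracle_def mincut_without_def decrement_two_def by blast
  qed
  \<comment> \<open>The two bounds on \<open>mincut_without\<close> leave a gap of one, so a
    threshold test decides membership without exact values.\<close>
  have decode: "E = {(i, j) \<in> L \<times> R. int (card (L \<union> R)) - 1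
      \<le> query (enc (graph E)) ((i, t, 0), -1) ((s, j, 0), -1)}" if "E \<subseteq> L \<times> R" for E
  proof -
    have "(i, j) \<in> E \<longleftrightarrow> int (card (L \<union> R)) - 1
      \<le> query (enc (graph E)) ((i, t, 0), -1) ((s, j, 0), -1)" if "i \<in> L" "j \<in> R" for i j
      unfolding answer[OF that]
      using mincut_with_arc[OF that, of E] mincut_without_arc[OF that, of E] by force
    then show ?thesis
      using that by auto
  qed
  show ?thesis
  proof (rule inj_onI)
    fix E E' assume "E \<in> Pow (L \<times> R)" "E' \<in> Pow (L \<times> R)" "enc (graph E) = enc (graph E')"
    then show "E = E'"
      using decode[of E] decode[of E'] by simp
  qed
qed

lemma oracle_space:
  assumes "dual_decrement_oracle (multigraphs n \<mu>) s t enc query" "1 \<le> \<mu>"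
  shows "\<exists>G\<in>multigraphs n \<mu>. card L * card R \<le> length (enc G)"
proof -
  have "finite (L \<times> R)"
    using finite_inner by simp
  then have "card (Pow (L \<times> R)) = 2 ^ (card L * card R)"
    by (simp add: card_Pow card_cartesian_product)
  then show ?thesis
    using inj_on_bool_lists_long[OF oracle_inj_on[OF assms]] graph_in_multigraphs[OF assms(2)]
    by (metis order_refl)
qed

end

theorem theorem33:
  shows "\<exists>c::real. c > 0 \<and>
    (\<forall>\<^sub>F n in sequentially.
      \<forall>(\<mu>::enat) (s::nat) (t::nat) enc query.
        1 \<le> \<mu> \<longrightarrow> s < n \<longrightarrow> t < n \<longrightarrow> s \<noteq> t \<longrightarrow>
        dual_decrement_oracle (multigraphs n \<mu>) s t enc query \<longrightarrow>
        (\<exists>G \<in> multigraphs n \<mu>. c * real n ^ 2 \<le> real (length (enc G))))"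
\<comment> \<open>From \<open>n = 6\<close> on, both halves of the \<open>n - 2\<close> inner
  vertices have at least \<open>n / 4\<close> elements, which gives \<open>n^2 / 16\<close>
  pairs.\<close>
proof (intro exI[of _ "1 / 16"] conjI eventually_sequentiallyI[of 6] allI impI)
  fix n s t :: nat and \<mu> enc query
  assume n: "6 \<le> n" and \<mu>: "1 \<le> \<mu>" and st: "s < n" "t < n" "s \<noteq> t"
    and query: "dual_decrement_oracle (multigraphs n \<mu>) s t enc query"
  let ?V = "{..<n} - {s, t}"
  have card_V: "card ?V = n - 2"
    using st by (simp add: card_Diff_subset)
  then obtain L where L: "L \<subseteq> ?V" "card L = (n - 2) div 2"
    using obtain_subset_with_card_n[of "(n - 2) div 2" ?V] by auto
  then have "finite L"
    using finite_subset by blast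
  then have card_R: "card (?V - L) = (n - 2) - (n - 2) div 2"
    using L card_V by (simp add: card_Diff_subset)
  interpret bipartite_gadget n s t L "?V - L"
    using L(1) st by unfold_locales auto
  obtain G where G: "G \<in> multigraphs n \<mu>" "card L * card (?V - L) \<le> length (enc G)"
    using oracle_space[OF query \<mu>] by blast
  have "n \<le> 4 * card L" "n \<le> 4 * card (?V - L)"
    unfolding L(2) card_R using n by linarith+
  then have "n * n \<le> (4 * card L) * (4 * card (?V - L))"
    by (rule mult_le_mono)
  then have "n\<^sup>2 \<le> 16 * length (enc G)"
    using G(2) by (simp add: power2_eq_square)
  then have "real n ^ 2 \<le> 16 * real (length (enc G))"
    by (metis of_nat_le_iff of_nat_mult of_nat_numeral of_nat_power)
  then show "\<exists>G\<in>multigraphs n \<mu>. 1 / 16 * real n ^ 2 \<le> real (length (enc G))"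
    using G(1) by (intro bexI[of _ G]) auto
qed simp

end
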